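(* Let $h$ be a non-negative similarity invariant function on $\mathrm{Sym}_2^+$. Let $\Lambda\subset P_m^+$ be the set of those $\alpha$ for which $f\mapsto H(f;\alpha)$ attains its minimum over $D$, and for each $\alpha\in\Lambda$ let $\hat f(\alpha)\in D$ be a minimizer of $f\mapsto H(f;\alpha)$ over $D$. Then the map $\hat f:\Lambda\to D$ is continuous at every $\alpha\in\Lambda$ for which $H(\cdot;\alpha)$ has a well separated global minimum, i.e. for which $$\inf\{H(f;\alpha): f\in D,\ \|f-\hat f(\alpha)\|\ge\varepsilon\}>H(\hat f(\alpha);\alpha)\quad\text{for every }\varepsilon>0$$ (with the convention $\inf\emptyset=+\infty$).
   Context: $\mathrm{Sym}_2^+$ is the set of real symmetric positive definite $2\times 2$ matrices. A similarity invariant function on $\mathrm{Sym}_2^+$ is a continuous function $h:\mathrm{Sym}_2^+\times \mathrm{Sym}_2^+\to\mathbb{R}$ with $h(AXA',AYA')=h(X,Y)$ for all $X,Y\in \mathrm{Sym}_2^+$ and $A\in GL_2(\mathbb{R})$ ($'$ denotes transpose); it is non-negative if $h(X,Y)\ge 0$ for all $X,Y$. For a positive integer $N$, $P_N^+=\{x\in\mathbb{R}^N: x_i\ge 0,\ \sum_i x_i=1\}$, with the Euclidean norm and topology. Fix points $p_1,\dots,p_k$ (distribution domain) and $q_1,\dots,q_k$ (observation points) on the unit sphere $\mathbb{S}^2\subset\mathbb{R}^3$, with $p_i\ne -q_j$ for all $i,j$. Let $\overrightarrow{q_jp_i}=\frac{\cos^{-1}\langle p_i,q_j\rangle}{(1-\langle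 p_i,q_j\rangle^2)^{1/2}}\,(p_i-\langle p_i,q_j\rangle q_j)$ (and $0$ if $p_i=q_j$), a vector of the tangent plane to $\mathbb{S}^2$ at $q_j$; fix a basis of each such tangent plane and regard $\overrightarrow{q_jp_i}$ as a column vector in $\mathbb{R}^2$. The norm $\|\overrightarrow{q_jp_i}\|$ is the Riemannian norm, i.e. the Euclidean norm in $\mathbb{R}^3$. Fix $r$ to be either $r\equiv 1$ or $r(t)=(1-\frac{\pi}{2t})^2$; in the latter case also $p_i\neq q_j$ for all $i,j$. For $f\in P_k^+$ put $$\Sigma[f]_j=\sum_{i=1}^k \overrightarrow{q_jp_i}\,(\overrightarrow{q_jp_i})'\, r(\|\overrightarrow{q_jp_i}\|)\, f_i,\qquad j=1,\dots,k.$$ Let $D=\{f\in P_k^+ : \Sigma[f]_j\in \mathrm{Sym}_2^+ \text{ for all } j\}$. Fix $f^1,\dots,f^m\in D$, put $C_j^s=\Sigma[f^s]_j$, and for $f\in D$, $\alpha\in P_m^+$ define $$H(f;\alpha)=\sum_{s=1}^m\alpha_s\sum_{j=1}^k h(\Sigma[f]_j,C_j^s).$$ *)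

theory Defs
  imports "HOL-Analysis.Analysis"
begin

definition sym_pos_def :: "(real^'n^'n) set" where
  "sym_pos_def = {X. transpose X = X \<and> (\<forall>v. v \<noteq> 0 \<longrightarrow> v \<bullet> (X *v v) > 0)}"

definition similarity_invariant :: "(real^'n^'n \<Rightarrow> real^'n^'n \<Rightarrow> real) \<Rightarrow> bool" where
  "similarity_invariant h \<longleftrightarrow>
     continuous_on (sym_pos_def \<times> sym_pos_def) (\<lambda>(X, Y). h X Y) \<and>
     (\<forall>X\<in>sym_pos_def. \<forall>Y\<in>sym_pos_def. \<forall>A. invertible A \<longrightarrow>
        h (A ** X ** transpose A) (A ** Y ** transpose A) = h X Y)"

definition prob_simplex :: "(real^'n) set" where
  "prob_simplex = {x. (\<forall>i. x $ i \<ge> 0) \<and> (\<Sum>i\<in>UNIV. x $ i) = 1}"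

text \<open>Riemannian logarithm on the unit sphere: the initial velocity at \<open>q\<close> of the minimal
  geodesic reaching \<open>p\<close> in unit time (\<open>p \<noteq> - q\<close>).\<close>

definition sphere_log :: "'a::real_inner \<Rightarrow> 'a \<Rightarrow> 'a" where
  "sphere_log q p =
     (if p = q then 0
      else (arccos (p \<bullet> q) / sqrt (1 - (p \<bullet> q)\<^sup>2)) *\<^sub>R (p - (p \<bullet> q) *\<^sub>R q))"

text \<open>An ordered basis, not necessarily orthonormal, of the tangent plane at \<open>q\<close> of the unit
  sphere, which is the orthogonal complement of \<open>q\<close>.\<close>

definition tangent_basis :: "real^3 \<Rightarrow> (2 \<Rightarrow> real^3) \<Rightarrow> bool" where
  "tangent_basis q b \<longleftrightarrow>
     inj b \<and> independent (range b) \<and> span (range b) = {v. v \<bullet> q = 0}"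

definition coords :: "(2 \<Rightarrow> real^3) \<Rightarrow> real^3 \<Rightarrow> real^2" where
  "coords b v = (\<chi> l. representation (range b) v (b l))"

definition outer :: "real^'n \<Rightarrow> real^'n^'n" where
  "outer v = (columnvector v :: real^1^'n) ** (rowvector v :: real^'n^1)"

definition Sigma_mat ::
  "('k::finite \<Rightarrow> real^3) \<Rightarrow> ('k \<Rightarrow> real^3) \<Rightarrow> ('k \<Rightarrow> 2 \<Rightarrow> real^3) \<Rightarrow> (real \<Rightarrow> real) \<Rightarrow>
   real^'k \<Rightarrow> 'k \<Rightarrow> real^2^2" where
  "Sigma_mat p q b r f j =
     (\<Sum>i\<in>UNIV. (r (norm (sphere_log (q j) (p i))) * f $ i) *\<^sub>R
        outer (coords (b j) (sphere_log (q j) (p i))))"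

definition admissible ::
  "('k::finite \<Rightarrow> real^3) \<Rightarrow> ('k \<Rightarrow> real^3) \<Rightarrow> ('k \<Rightarrow> 2 \<Rightarrow> real^3) \<Rightarrow> (real \<Rightarrow> real) \<Rightarrow>
   (real^'k) set" where
  "admissible p q b r = {f \<in> prob_simplex. \<forall>j. Sigma_mat p q b r f j \<in> sym_pos_def}"

text \<open>\<open>S\<close> plays the role of \<open>Sigma_mat p q b r\<close> below.\<close>

definition objective ::
  "(real^2^2 \<Rightarrow> real^2^2 \<Rightarrow> real) \<Rightarrow> (real^'k \<Rightarrow> 'k::finite \<Rightarrow> real^2^2) \<Rightarrow>
   ('m::finite \<Rightarrow> real^'k) \<Rightarrow> real^'k \<Rightarrow> real^'m \<Rightarrow> real" where
  "objective h S fs f \<alpha> = (\<Sum>s\<in>UNIV. \<alpha> $ s * (\<Sum>j\<in>UNIV. h (S f j) (S (fs s) j)))"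

text \<open>The infimum is taken in \<^typ>\<open>ereal\<close>, where the infimum of the empty set is \<open>\<infinity>\<close>.\<close>

definition well_separated_min :: "('a::real_normed_vector \<Rightarrow> real) \<Rightarrow> 'a set \<Rightarrow> 'a \<Rightarrow> bool" where
  "well_separated_min F D x \<longleftrightarrow>
     (\<forall>\<epsilon>>0. (INF y\<in>{y \<in> D. norm (y - x) \<ge> \<epsilon>}. ereal (F y)) > ereal (F x))"

end

theory Submission
  imports Defs
begin

text \<open>The objective is \<open>H(f; \<alpha>) = \<Sum>s. \<alpha>\<^sub>s d\<^sub>s(f)\<close> with \<open>d\<^sub>s \<ge> 0\<close>. Let \<open>\<alpha>\<close> tend to \<open>\<alpha>\<^sub>0\<close>. For any fixed \<open>t < 1\<close>, eventually
  \<open>\<alpha> \<ge> t \<alpha>\<^sub>0\<close> componentwise (trivially so where \<open>\<alpha>\<^sub>0\<close> vanishes), hence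
  \<open>t H(f(\<alpha>); \<alpha>\<^sub>0) \<le> H(f(\<alpha>); \<alpha>) \<le> H(f(\<alpha>\<^sub>0); \<alpha>) \<longlongrightarrow> H(f(\<alpha>\<^sub>0); \<alpha>\<^sub>0)\<close> for minimizers \<open>f(\<alpha>)\<close>. So \<open>f(\<alpha>)\<close>
  cannot stay outside a ball around \<open>f(\<alpha>\<^sub>0)\<close>, where \<open>H(\<cdot>; \<alpha>\<^sub>0)\<close> exceeds its minimum by a margin.\<close>

text \<open>The infimum over the points at distance at least \<epsilon> is \<infinity> when there
  are none, so it cannot serve as a real threshold itself. Density of the reals in
  \<open>ereal\<close> supplies a finite \<open>m\<close> strictly below it.\<close>

lemma well_separated_minD:
  assumes "well_separated_min F D x" "\<epsilon> > 0"
  obtains m where "F x < m" "\<And>y. y \<in> D \<Longrightarrow> norm (y - x) \<ge> \<epsilon> \<Longrightarrow> m \<le> F y"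
proof -
  have "ereal (F x) < (INF y\<in>{y \<in> D. norm (y - x) \<ge> \<epsilon>}. ereal (F y))"
    using assms by (simp add: well_separated_min_def)
  then obtain m where m: "ereal (F x) < ereal m"
      "ereal m < (INF y\<in>{y \<in> D. norm (y - x) \<ge> \<epsilon>}. ereal (F y))"
    using ereal_dense2 by blast
  have "m \<le> F y" if "y \<in> D" "norm (y - x) \<ge> \<epsilon>" for y
    using less_INF_D[OF m(2), of y] that by simp
  with m(1) show thesis by (intro that) auto
qed

text \<open>Separates the perturbation argument from the geometry: the weights enter linearly, and
  \<open>d s\<close> absorbs everything that does not depend on them. Nonnegative costs turn a
  componentwise lower bound on the weights into a lower bound on \<open>F\<close>, uniformly over
  \<open>D\<close>.\<close>

lemma continuous_arg_min_weighted_sum: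
  fixes d :: "'m::finite \<Rightarrow> 'a::real_normed_vector \<Rightarrow> real"
    and \<Lambda> :: "(real^'m) set" and x :: "real^'m \<Rightarrow> 'a"
  defines "F \<equiv> \<lambda>\<alpha> y. \<Sum>s\<in>UNIV. \<alpha> $ s * d s y"
  assumes d_nonneg: "\<And>s y. y \<in> D \<Longrightarrow> 0 \<le> d s y"
    and \<Lambda>_nonneg: "\<And>\<alpha> s. \<alpha> \<in> \<Lambda> \<Longrightarrow> 0 \<le> \<alpha> $ s"
    and x_min: "\<And>\<alpha>. \<alpha> \<in> \<Lambda> \<Longrightarrow> is_arg_min (F \<alpha>) (\<lambda>y. y \<in> D) (x \<alpha>)"
    and "\<alpha>\<^sub>0 \<in> \<Lambda>" and sep: "well_separated_min (F \<alpha>\<^sub>0) D (x \<alpha>\<^sub>0)"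
  shows "continuous (at \<alpha>\<^sub>0 within \<Lambda>) x"
  unfolding continuous_within
proof (rule tendstoI)
  fix \<epsilon> :: real assume "\<epsilon> > 0"
  have xD: "x \<alpha> \<in> D" and x_le: "\<And>y. y \<in> D \<Longrightarrow> F \<alpha> (x \<alpha>) \<le> F \<alpha> y" if "\<alpha> \<in> \<Lambda>" for \<alpha>
    using x_min[OF that] by (auto simp: is_arg_min_linorder)
  obtain m where m: "F \<alpha>\<^sub>0 (x \<alpha>\<^sub>0) < m" "\<And>y. y \<in> D \<Longrightarrow> norm (y - x \<alpha>\<^sub>0) \<ge> \<epsilon> \<Longrightarrow> m \<le> F \<alpha>\<^sub>0 y"
    using well_separated_minD[OF sep \<open>\<epsilon> > 0\<close>] by blast
  have "0 \<le> F \<alpha>\<^sub>0 (x \<alpha>\<^sub>0)"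
    unfolding F_def using \<open>\<alpha>\<^sub>0 \<in> \<Lambda>\<close> xD by (intro sum_nonneg mult_nonneg_nonneg \<Lambda>_nonneg d_nonneg)
  with m(1) have "m > 0" "F \<alpha>\<^sub>0 (x \<alpha>\<^sub>0) / m < 1" by simp_all
  \<comment> \<open>The lower bound on \<open>t\<close> keeps \<open>t * m\<close> above the minimum
    value at \<open>\<alpha>\<^sub>0\<close>; \<open>t < 1\<close> leaves each positive weight room
    to decrease slightly.\<close>
  then obtain t where t: "F \<alpha>\<^sub>0 (x \<alpha>\<^sub>0) / m < t" "t < 1" using dense by blast
  have "0 \<le> F \<alpha>\<^sub>0 (x \<alpha>\<^sub>0) / m" using \<open>0 \<le> F \<alpha>\<^sub>0 (x \<alpha>\<^sub>0)\<close> \<open>m > 0\<close> by simp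
  with t(1) have "t > 0" by linarith
  have tm: "F \<alpha>\<^sub>0 (x \<alpha>\<^sub>0) < t * m" using t(1) \<open>m > 0\<close> by (simp add: field_simps)
  have in_\<Lambda>: "\<forall>\<^sub>F \<alpha> in at \<alpha>\<^sub>0 within \<Lambda>. \<alpha> \<in> \<Lambda>"
    by (simp add: eventually_at_filter)
  have comp: "((\<lambda>\<alpha>. \<alpha> $ s) \<longlongrightarrow> \<alpha>\<^sub>0 $ s) (at \<alpha>\<^sub>0 within \<Lambda>)" for s
    by (intro tendsto_vec_nth tendsto_ident_at)
  have "\<forall>\<^sub>F \<alpha> in at \<alpha>\<^sub>0 within \<Lambda>. t * \<alpha>\<^sub>0 $ s \<le> \<alpha> $ s" for s
  proof (cases "\<alpha>\<^sub>0 $ s = 0")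
    case True
    show ?thesis using in_\<Lambda> by eventually_elim (simp add: True \<Lambda>_nonneg)
  next
    case False
    then have "\<alpha>\<^sub>0 $ s > 0" using \<Lambda>_nonneg[OF \<open>\<alpha>\<^sub>0 \<in> \<Lambda>\<close>, of s] by simp
    then have "t * \<alpha>\<^sub>0 $ s < \<alpha>\<^sub>0 $ s" using t(2) by simp
    from order_tendstoD(1)[OF comp this] show ?thesis by eventually_elim simp
  qed
  \<comment> \<open>There are finitely many weights, so one neighbourhood serves all of
    them.\<close>
  then have "\<forall>\<^sub>F \<alpha> in at \<alpha>\<^sub>0 within \<Lambda>. \<forall>s. t * \<alpha>\<^sub>0 $ s \<le> \<alpha> $ s"
    by (rule eventually_all_finite)
  \<comment> \<open>The competitor \<open>x \<alpha>\<^sub>0\<close> stays fixed, so its value is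
    linear in \<alpha>.\<close>
  moreover have "((\<lambda>\<alpha>. F \<alpha> (x \<alpha>\<^sub>0)) \<longlongrightarrow> F \<alpha>\<^sub>0 (x \<alpha>\<^sub>0)) (at \<alpha>\<^sub>0 within \<Lambda>)"
    unfolding F_def by (intro tendsto_intros comp)
  then have "\<forall>\<^sub>F \<alpha> in at \<alpha>\<^sub>0 within \<Lambda>. F \<alpha> (x \<alpha>\<^sub>0) < t * m"
    using tm by (rule order_tendstoD)
  ultimately show "\<forall>\<^sub>F \<alpha> in at \<alpha>\<^sub>0 within \<Lambda>. dist (x \<alpha>) (x \<alpha>\<^sub>0) < \<epsilon>"
    using in_\<Lambda>
  proof eventually_elim
    case (elim \<alpha>)
    show ?case
    \<comment> \<open>If \<open>x \<alpha>\<close> were far from \<open>x \<alpha>\<^sub>0\<close>,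
      its value \<open>F \<alpha> (x \<alpha>)\<close> would be at least \<open>t * m\<close>, yet
      the competitor \<open>x \<alpha>\<^sub>0\<close> achieves less.\<close>
    proof (rule ccontr)
      assume "\<not> ?case"
      then have "m \<le> F \<alpha>\<^sub>0 (x \<alpha>)" using xD[OF elim(3)] by (intro m(2)) (auto simp: dist_norm)
      then have "t * m \<le> t * F \<alpha>\<^sub>0 (x \<alpha>)" using \<open>t > 0\<close> by simp
      also have "\<dots> = (\<Sum>s\<in>UNIV. t * \<alpha>\<^sub>0 $ s * d s (x \<alpha>))"
        by (simp add: F_def sum_distrib_left mult.assoc)
      also have "\<dots> \<le> F \<alpha> (x \<alpha>)"
        unfolding F_def using elim(1) xD[OF elim(3)] d_nonneg by (intro sum_mono mult_right_mono) auto
      also have "\<dots> \<le> F \<alpha> (x \<alpha>\<^sub>0)" using elim(3) xD[OF \<open>\<alpha>\<^sub>0 \<in> \<Lambda>\<close>] by (rule x_le)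
      finally show False using elim(2) by simp
    qed
  qed
qed

theorem corollary1:
  fixes h :: "real^2^2 \<Rightarrow> real^2^2 \<Rightarrow> real"
    and p q :: "'k::finite \<Rightarrow> real^3"
    and b :: "'k \<Rightarrow> 2 \<Rightarrow> real^3"
    and r :: "real \<Rightarrow> real"
    and fs :: "'m::finite \<Rightarrow> real^'k"
    and D :: "(real^'k) set"
    and H :: "real^'k \<Rightarrow> real^'m \<Rightarrow> real"
    and \<Lambda> :: "(real^'m) set"
    and fhat :: "real^'m \<Rightarrow> real^'k"
  assumes "similarity_invariant h"
    and "\<forall>X\<in>sym_pos_def. \<forall>Y\<in>sym_pos_def. h X Y \<ge> 0"
    and "\<forall>i. p i \<in> sphere 0 1"
    and "\<forall>j. q j \<in> sphere 0 1"
    and "\<forall>i j. p i \<noteq> - q j"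
    and "\<forall>j. tangent_basis (q j) (b j)"
    and "r = (\<lambda>t. 1) \<or> r = (\<lambda>t. (1 - pi / (2 * t))\<^sup>2) \<and> (\<forall>i j. p i \<noteq> q j)"
    and "D = admissible p q b r"
    and "\<forall>s. fs s \<in> D"
    and "H = objective h (Sigma_mat p q b r) fs"
    and "\<Lambda> = {\<alpha> \<in> prob_simplex. \<exists>f. is_arg_min (\<lambda>f. H f \<alpha>) (\<lambda>f. f \<in> D) f}"
    and "\<forall>\<alpha>\<in>\<Lambda>. is_arg_min (\<lambda>f. H f \<alpha>) (\<lambda>f. f \<in> D) (fhat \<alpha>)"
  shows "\<forall>\<alpha>\<in>\<Lambda>. well_separated_min (\<lambda>f. H f \<alpha>) D (fhat \<alpha>) \<longrightarrow>
           continuous (at \<alpha> within \<Lambda>) fhat"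
proof (intro ballI impI)
  fix \<alpha> assume \<alpha>: "\<alpha> \<in> \<Lambda>" "well_separated_min (\<lambda>f. H f \<alpha>) D (fhat \<alpha>)"
  define d where "d s f = (\<Sum>j\<in>UNIV. h (Sigma_mat p q b r f j) (Sigma_mat p q b r (fs s) j))" for s f
  have H: "(\<lambda>f. H f \<beta>) = (\<lambda>f. \<Sum>s\<in>UNIV. \<beta> $ s * d s f)" for \<beta>
    by (simp add: assms(10) objective_def d_def)
  show "continuous (at \<alpha> within \<Lambda>) fhat"
  proof (rule continuous_arg_min_weighted_sum)
    \<comment> \<open>Both \<open>f\<close> and \<open>fs s\<close> lie in \<open>D\<close>, so both
      arguments of \<open>h\<close> are positive definite, where \<open>h\<close> is
      nonnegative.\<close>
    show "0 \<le> d s f" if "f \<in> D" for s f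
      using that assms(2,8,9) by (auto simp: d_def admissible_def intro!: sum_nonneg)
    show "0 \<le> \<beta> $ s" if "\<beta> \<in> \<Lambda>" for \<beta> s
      using that assms(11) by (simp add: prob_simplex_def)
    show "is_arg_min (\<lambda>f. \<Sum>s\<in>UNIV. \<beta> $ s * d s f) (\<lambda>f. f \<in> D) (fhat \<beta>)" if "\<beta> \<in> \<Lambda>" for \<beta>
      using that assms(12) by (simp flip: H)
    show "well_separated_min (\<lambda>f. \<Sum>s\<in>UNIV. \<alpha> $ s * d s f) D (fhat \<alpha>)"
      using \<alpha>(2) by (simp flip: H)
  qed (fact \<alpha>(1))
qed

end
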